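(* Let $X$ be a reflexive Banach space, let $K$ be a nonempty convex closed subset of $X$, let $D\subseteq K$ be a self segment-dense set in $K$ with respect to the weak topology of $X$, and let $F:K\times K\rightrightarrows\mathbb{R}$ be a set-valued map satisfying: (i) for all $y\in D$, the map $x\mapsto F(x,y)$ is weakly upper semicontinuous on $K$; (ii) for all $x\in K$, the map $y\mapsto F(x,y)$ is weakly upper semicontinuous on $K\setminus D$; (iii) for all $x\in K$, the map $y\mapsto F(x,y)$ is concave on $D$; (iv) for all $x\in D$, $F(x,x)\cap\mathbb{R}_+\neq\emptyset$; (v) there exists $r>0$ such that for all $x\in K$ with $\|x\|\le r$ there exists $y_0\in D$ with $\|y_0\|<r$ and $F(x,y_0)\le 0$. Then there exists an element $x_0\in K$ such that $F(x_0,y)\cap\mathbb{R}_+\neq\emptyset$ for all $y\in K$.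
   Context: Self segment-dense: for $U\subseteq V\subseteq X$ with $V$ convex and $X$ equipped with a vector topology (here the weak topology), $U$ is self segment-dense in $V$ if $U$ is dense in $V$ (i.e. $V\subseteq\operatorname{cl}(U)$) and for all $x,y\in U$ the set $[x,y]\cap U$ is dense in the closed segment $[x,y]=\{x+t(y-x):t\in[0,1]\}$. Notation: $\mathbb{R}_+=[0,\infty)$; $F(x,y)\le 0$ means $u\le 0$ for all $u\in F(x,y)$. Upper semicontinuity: a set-valued map $T:A\rightrightarrows\mathbb{R}$ on a topological space $A$, with domain $D(T)=\{x\in A:T(x)\ne\emptyset\}$, is upper semicontinuous at $x\in D(T)$ if for every open $N\subseteq\mathbb{R}$ with $T(x)\subseteq N$ there is a neighborhood $M$ of $x$ in $A$ such that $T(y)\subseteq N$ for all $y\in M$. It is upper semicontinuous on $S\subseteq A$ if it is upper semicontinuous at every point of $S$ (so in particular $S\subseteq D(T)$); here $T$ is still regarded as a map on all of $A$. Weakly upper semicontinuous means upper semicontinuous when $A=K$ carries the topology induced by the weak topology of $X$. Concavity on a not necessarily convex set: $T$ is concave on $D$ if for all $x_1,\dots,x_n\in D$ and $\lambda_i\ge0$ with $\sum_{i=1}^n\lambda_i=1$ and $\sum_{i=1}^n\lambda_ix_i\in D$ one has $\sum_{i=1}^n\lambda_iT(x_i)\supseteq T\left(\sum_{i=1}^n\lambda_ix_i\right)$ (Minkowski sum).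
   Formalization: Condition (v) additionally requires that some x in K has norm at most r; without this (v) can hold vacuously and the claim fails, e.g. X = R, K = D = [1,∞), F(x,y) = {x − y}, r = 1/2. *)

theory Defs
  imports "HOL-Analysis.Analysis" "HOL-Library.Set_Algebras"
begin

text \<open>
  \<^const>\<open>blinfun.prod_left\<close> sends \<open>x\<close> to the functional \<open>\<lambda>f. f x\<close> on the dual
  space; it is the canonical embedding of the space into its bidual.
\<close>

definition reflexive_space :: "'a::real_normed_vector itself \<Rightarrow> bool" where
  "reflexive_space (_ :: 'a itself) \<longleftrightarrow>
     surj (blinfun.prod_left :: 'a \<Rightarrow> ('a \<Rightarrow>\<^sub>L real) \<Rightarrow>\<^sub>L real)"

definition weak_topology :: "'a::real_normed_vector topology" where
  "weak_topology = topology_generated_by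
     {blinfun_apply f -` U | (f :: 'a \<Rightarrow>\<^sub>L real) U. open U}"

definition self_segment_dense_in ::
    "'a::real_vector topology \<Rightarrow> 'a set \<Rightarrow> 'a set \<Rightarrow> bool" where
  "self_segment_dense_in W U V \<longleftrightarrow>
     U \<subseteq> V \<and> convex V \<and> V \<subseteq> W closure_of U \<and>
     (\<forall>x\<in>U. \<forall>y\<in>U. closed_segment x y \<subseteq> W closure_of (closed_segment x y \<inter> U))"

definition usc_at ::
    "'a topology \<Rightarrow> ('a \<Rightarrow> 'b::topological_space set) \<Rightarrow> 'a \<Rightarrow> bool" where
  "usc_at A T x \<longleftrightarrow> x \<in> topspace A \<and> T x \<noteq> {} \<and>
     (\<forall>N. open N \<and> T x \<subseteq> N \<longrightarrow> (\<exists>M. openin A M \<and> x \<in> M \<and> (\<forall>y\<in>M. T y \<subseteq> N)))"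

text \<open>
  Neighborhoods are open sets of the whole space \<open>A\<close>, not of the subspace \<open>S\<close>.
\<close>

definition usc_on ::
    "'a topology \<Rightarrow> 'a set \<Rightarrow> ('a \<Rightarrow> 'b::topological_space set) \<Rightarrow> bool" where
  "usc_on A S T \<longleftrightarrow> (\<forall>x\<in>S. usc_at A T x)"

text \<open>
  The set \<open>D\<close> need not be convex. The sum on the right is the Minkowski sum;
  \<open>a *o S\<close> is \<open>{a * s | s. s \<in> S}\<close>, so it is empty whenever \<open>S\<close> is, also for \<open>a = 0\<close>.
\<close>

definition set_valued_concave_on ::
    "'a::real_vector set \<Rightarrow> ('a \<Rightarrow> real set) \<Rightarrow> bool" where
  "set_valued_concave_on D T \<longleftrightarrow>
     (\<forall>(n::nat) (x :: nat \<Rightarrow> 'a) (l :: nat \<Rightarrow> real).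
        (\<forall>i\<in>{1..n}. x i \<in> D \<and> 0 \<le> l i) \<and> (\<Sum>i=1..n. l i) = 1 \<and>
        (\<Sum>i=1..n. l i *\<^sub>R x i) \<in> D \<longrightarrow>
        T (\<Sum>i=1..n. l i *\<^sub>R x i) \<subseteq> (\<Sum>i=1..n. l i *o T (x i)))"

end

theory Submission
  imports Defs
begin

text \<open>
  Let \<open>C\<close> be the part of \<open>K\<close> in the ball of radius \<open>r\<close>; it is weakly compact by reflexivity.
  By (i) the sets \<open>G y = {x \<in> K. F x y \<inter> {0..} \<noteq> {}}\<close>, \<open>y \<in> D\<close>, are weakly closed, and by (iii)
  and (iv) they cover \<open>convex hull A \<inter> D\<close> for every finite set \<open>A \<subseteq> D\<close> of indices; as \<open>D\<close> is
  segment-dense, they cover the whole hull. The KKM theorem then gives a point \<open>x\<^sub>0 \<in> C\<close>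
  that lies in \<open>G y\<close> for all \<open>y \<in> D \<inter> C\<close>. A point \<open>y \<in> D\<close> outside the ball is joined to the point
  \<open>y\<^sub>0\<close> of (v): the segment contains points of \<open>D\<close> near \<open>y\<^sub>0\<close>, and concavity carries
  \<open>F x\<^sub>0 y\<^sub>0 \<le> 0\<close> over to \<open>y\<close>. Density and (ii) take care of \<open>K - D\<close>.
\<close>

section \<open>The Hahn--Banach theorem\<close>

definition sublinear :: "('a::real_vector \<Rightarrow> real) \<Rightarrow> bool" where
  "sublinear p \<longleftrightarrow> (\<forall>x y. p (x + y) \<le> p x + p y) \<and> (\<forall>c\<ge>0. \<forall>x. p (c *\<^sub>R x) = c * p x)"

lemma sublinearI:
  assumes add: "\<And>x y. p (x + y) \<le> p x + p y"
    and scale: "\<And>c x. c > 0 \<Longrightarrow> p (c *\<^sub>R x) \<le> c * p x"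
    and zero: "p 0 = 0"
  shows "sublinear p"
proof -
  have "p (c *\<^sub>R x) = c * p x" if "c \<ge> 0" for c x
  proof (cases "c = 0")
    case True
    then show ?thesis by (simp add: zero)
  next
    case False
    with that have c: "c > 0" by simp
    have "p (inverse c *\<^sub>R (c *\<^sub>R x)) \<le> inverse c * p (c *\<^sub>R x)"
      using c by (intro scale) simp
    then have "c * p x \<le> p (c *\<^sub>R x)"
      using c by (simp add: field_simps)
    with scale[OF c, of x] show ?thesis by simp
  qed
  with add show ?thesis by (simp add: sublinear_def)
qed

lemma sublinear_add: "sublinear p \<Longrightarrow> p (x + y) \<le> p x + p y"
  by (simp add: sublinear_def)

lemma sublinear_scale: "sublinear p \<Longrightarrow> c \<ge> 0 \<Longrightarrow> p (c *\<^sub>R x) = c * p x"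
  by (simp add: sublinear_def)

lemma sublinear_zero: "sublinear p \<Longrightarrow> p 0 = 0"
  using sublinear_scale[of p 0 0] by simp

lemma sublinear_minus: "sublinear p \<Longrightarrow> - p (- x) \<le> p x"
  using sublinear_add[of p x "- x"] sublinear_zero[of p] by simp

lemma sublinear_norm: "sublinear (norm :: 'a::real_normed_vector \<Rightarrow> real)"
  by (auto simp: sublinear_def norm_triangle_ineq)

text \<open>The infimum of \<open>p (v + t *\<^sub>R k) - t * d\<close> over
  \<open>t \<ge> 0\<close> and \<open>k \<in> C\<close> is the largest such function. A linear
  minorant of \<open>q\<close> is at least \<open>d\<close> on \<open>C\<close>, so separation is
  built into the dominating function.\<close>

lemma sublinear_minorant_on_convex:
  fixes p :: "'a::real_vector \<Rightarrow> real"
  assumes p: "sublinear p" and C: "convex C" "C \<noteq> {}" and d: "\<And>k. k \<in> C \<Longrightarrow> d \<le> p k"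
  obtains q where "sublinear q" "\<And>v. q v \<le> p v" "\<And>k. k \<in> C \<Longrightarrow> q (- k) \<le> - d"
proof -
  \<comment> \<open>\<open>T\<close> is the convex cone over \<open>{1} \<times> C\<close>;
    \<open>t\<close> is kept beside \<open>t *\<^sub>R k\<close> because the vector alone need not
    determine it.\<close>
  define T where "T = {(t, t *\<^sub>R k) | t k. t \<ge> 0 \<and> k \<in> C}"
  define h where "h v = (\<lambda>(t, w). p (v + w) - t * d)" for v
  define q where "q v = (INF z\<in>T. h v z)" for v
  have T0: "(0, 0) \<in> T" using C(2) by (force simp: T_def)
  have T_add: "(s + t, v + w) \<in> T" if sv: "(s, v) \<in> T" and tw: "(t, w) \<in> T" for s t v w
  proof -
    obtain k l where kl: "s \<ge> 0" "t \<ge> 0" "k \<in> C" "l \<in> C" "v = s *\<^sub>R k" "w = t *\<^sub>R l"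
      using sv tw by (auto simp: T_def)
    show ?thesis
    proof (cases "s + t = 0")
      case True
      then have "s = 0" "t = 0" using kl by auto
      then show ?thesis using T0 kl by simp
    next
      case False
      then have st: "s + t > 0" using kl by auto
      let ?m = "(s / (s + t)) *\<^sub>R k + (t / (s + t)) *\<^sub>R l"
      have "?m \<in> C"
        using C(1) kl st by (intro convexD) (auto simp flip: add_divide_distrib)
      moreover have "v + w = (s + t) *\<^sub>R ?m"
        using st kl by (simp add: scaleR_add_right)
      ultimately show ?thesis using kl by (auto simp: T_def)
    qed
  qed
  have T_scale: "(c * t, c *\<^sub>R w) \<in> T" if tw: "(t, w) \<in> T" and c: "c > 0" for c t w
  proof -
    from tw obtain k where "t \<ge> 0" "k \<in> C" "w = t *\<^sub>R k" by (auto simp: T_def)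
    with c show ?thesis by (auto simp: T_def intro!: exI[of _ "c * t"])
  qed
  \<comment> \<open>Here \<open>d \<le> p k\<close> enters: it bounds the infimum from below, and at
    \<open>v = 0\<close> it yields \<open>q 0 \<ge> 0\<close>.\<close>
  have lb: "- p (- v) \<le> h v z" if zT: "z \<in> T" for v z
  proof -
    obtain t k where z: "z = (t, t *\<^sub>R k)" "t \<ge> 0" "k \<in> C"
      using zT unfolding T_def by blast
    have "t * d \<le> p (t *\<^sub>R k)" using z d by (simp add: sublinear_scale[OF p] mult_left_mono)
    also have "\<dots> \<le> p (v + t *\<^sub>R k) + p (- v)"
      using sublinear_add[OF p, of "v + t *\<^sub>R k" "- v"] by simp
    finally show ?thesis by (simp add: h_def z)
  qed
  have bdd: "bdd_below (h v ` T)" for v using lb by (force intro: bdd_belowI)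
  have le: "q v \<le> h v z" if "z \<in> T" for v z
    unfolding q_def using bdd that by (rule cINF_lower)
  have qp: "q v \<le> p v" for v using le[OF T0, of v] by (simp add: h_def)
  have "sublinear q"
  proof (rule sublinearI)
    fix x y
    have step: "q (x + y) \<le> h x z + h y z'" if z: "z \<in> T" "z' \<in> T" for z z'
    proof -
      obtain s v t w where [simp]: "z = (s, v)" "z' = (t, w)" by (metis surj_pair)
      have "q (x + y) \<le> h (x + y) (s + t, v + w)" using T_add z by (intro le) auto
      also have "\<dots> \<le> h x z + h y z'"
        using sublinear_add[OF p, of "x + v" "y + w"] by (simp add: h_def algebra_simps)
      finally show ?thesis .
    qed
    have "q (x + y) - h y z' \<le> q x" if "z' \<in> T" for z'
      unfolding q_def[of x] using T0 step[OF _ that] by (intro cINF_greatest) (auto simp: algebra_simps)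
    then have "q (x + y) - q x \<le> q y"
      unfolding q_def[of y] using T0 by (intro cINF_greatest) (auto simp: algebra_simps)
    then show "q (x + y) \<le> q x + q y" by simp
  next
    fix c :: real and x assume c: "c > 0"
    have "q (c *\<^sub>R x) / c \<le> q x" unfolding q_def[of x]
    proof (rule cINF_greatest)
      fix z assume z: "z \<in> T"
      obtain t w where [simp]: "z = (t, w)" by (metis surj_pair)
      have "q (c *\<^sub>R x) \<le> h (c *\<^sub>R x) (c * t, c *\<^sub>R w)" using T_scale[OF _ c] z by (intro le) simp
      also have "\<dots> = c * h x z"
        using c sublinear_scale[OF p, of c "x + w"] by (simp add: h_def algebra_simps)
      finally show "q (c *\<^sub>R x) / c \<le> h x z" using c by (simp add: field_simps)
    qed (use T0 in auto)
    then show "q (c *\<^sub>R x) \<le> c * q x" using c by (simp add: field_simps)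
  next
    have "- p (- 0) \<le> q 0" unfolding q_def using T0 lb[of _ 0] by (intro cINF_greatest) auto
    then show "q 0 = 0" using qp[of 0] sublinear_zero[OF p] by simp
  qed
  moreover have "q (- k) \<le> - d" if "k \<in> C" for k
  proof -
    have "(1, k) \<in> T" using that by (force simp: T_def)
    from le[OF this, of "- k"] show ?thesis by (simp add: h_def sublinear_zero[OF p])
  qed
  ultimately show thesis using qp that by blast
qed

text \<open>Supplies the chain bounds for Zorn's lemma. Values at \<open>v\<close> stay above
  \<open>- p (- v)\<close>, and the infimum is subadditive because the smaller of two members of a
  chain serves both arguments.\<close>

lemma Inf_chain_sublinear:
  fixes p :: "'a::real_vector \<Rightarrow> real"
  assumes C: "C \<noteq> {}" "\<And>q. q \<in> C \<Longrightarrow> sublinear q" "\<And>q v. q \<in> C \<Longrightarrow> q v \<le> p v"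
    and total: "\<And>q r. q \<in> C \<Longrightarrow> r \<in> C \<Longrightarrow> (\<forall>v. q v \<le> r v) \<or> (\<forall>v. r v \<le> q v)"
  obtains u where "sublinear u" "\<And>q v. q \<in> C \<Longrightarrow> u v \<le> q v"
proof -
  define u where "u v = (INF q\<in>C. q v)" for v
  have "- p (- v) \<le> q v" if "q \<in> C" for q v
    using sublinear_minus[OF C(2)[OF that], of v] C(3)[OF that, of "- v"] by simp
  then have bdd: "bdd_below ((\<lambda>q. q v) ` C)" for v by (force intro: bdd_belowI)
  have le: "u v \<le> q v" if "q \<in> C" for q v
    unfolding u_def using bdd that by (rule cINF_lower)
  have "sublinear u"
  proof (rule sublinearI)
    fix x y
    have step: "u (x + y) \<le> q x + r y" if qr: "q \<in> C" "r \<in> C" for q r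
    proof -
      obtain s where s: "s \<in> C" "\<And>v. s v \<le> q v" "\<And>v. s v \<le> r v"
        using total[OF qr] qr by (metis order_refl)
      have "u (x + y) \<le> s x + s y"
        using le[OF s(1), of "x + y"] sublinear_add[OF C(2)[OF s(1)], of x y] by simp
      with s(2)[of x] s(3)[of y] show ?thesis by simp
    qed
    have "u (x + y) - r y \<le> u x" if "r \<in> C" for r
      unfolding u_def[of x] using C(1) step[OF _ that] by (intro cINF_greatest) (auto simp: algebra_simps)
    then have "u (x + y) - u x \<le> u y"
      unfolding u_def[of y] using C(1) by (intro cINF_greatest) (auto simp: algebra_simps)
    then show "u (x + y) \<le> u x + u y" by simp
  next
    fix c :: real and x assume c: "c > 0"
    have "u (c *\<^sub>R x) / c \<le> u x" unfolding u_def[of x]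
    proof (rule cINF_greatest)
      fix q assume q: "q \<in> C"
      have "u (c *\<^sub>R x) \<le> c * q x"
        using le[OF q, of "c *\<^sub>R x"] c sublinear_scale[OF C(2)[OF q], of c x] by simp
      then show "u (c *\<^sub>R x) / c \<le> q x" using c by (simp add: field_simps)
    qed (use C in auto)
    then show "u (c *\<^sub>R x) \<le> c * u x" using c by (simp add: field_simps)
  next
    have "(\<lambda>q. q 0) ` C = {0}" using C(1) sublinear_zero[OF C(2)] by force
    then show "u 0 = 0" by (simp add: u_def)
  qed
  with le that show thesis by blast
qed

text \<open>\<open>sublinear_minorant_on_convex\<close> with \<open>C = {a}\<close> and
  \<open>d = m a\<close> lowers the value at \<open>- a\<close> to at most \<open>- m a\<close>. By
  minimality nothing was lowered, so \<open>m\<close> is odd, and an odd sublinear function is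
  linear.\<close>

lemma minimal_sublinear_imp_linear:
  fixes m :: "'a::real_vector \<Rightarrow> real"
  assumes m: "sublinear m"
    and min: "\<And>q. sublinear q \<Longrightarrow> (\<And>v. q v \<le> m v) \<Longrightarrow> q = m"
  shows "linear m"
proof -
  have minus: "m (- a) = - m a" for a
  proof -
    obtain q where "sublinear q" "\<And>v. q v \<le> m v" and q: "q (- a) \<le> - m a"
      using sublinear_minorant_on_convex[OF m, of "{a}" "m a"] by auto
    then have "m (- a) \<le> - m a" using min by force
    with sublinear_minus[OF m, of a] show ?thesis by simp
  qed
  show ?thesis
  proof (rule linearI)
    show "m (x + y) = m x + m y" for x y
      using sublinear_add[OF m, of x y] sublinear_add[OF m, of "x + y" "- y"] by (simp add: minus)
    show "m (c *\<^sub>R x) = c *\<^sub>R m x" for c x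
    proof (cases "c \<ge> 0")
      case True
      then show ?thesis by (simp add: sublinear_scale[OF m])
    next
      case False
      then have "m ((- c) *\<^sub>R x) = - c * m x" by (intro sublinear_scale[OF m]) simp
      then show ?thesis using minus[of "c *\<^sub>R x"] by simp
    qed
  qed
qed

text \<open>Hahn--Banach with no subspace to extend from: a Zorn-minimal sublinear function below
  \<open>p\<close> is linear, and constraints on \<open>f\<close> are encoded in \<open>p\<close>
  beforehand.\<close>

theorem sublinear_dominates_linear:
  fixes p :: "'a::real_vector \<Rightarrow> real"
  assumes p: "sublinear p"
  obtains f where "linear f" "\<And>v. f v \<le> p v"
proof -
  define A where "A = {q. sublinear q \<and> (\<forall>v. q v \<le> p v)}"
  \<comment> \<open>The order is reversed, so the maximal element of Zorn's lemma is a minimal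
    function.\<close>
  define P where "P q r \<longleftrightarrow> (\<forall>v. r v \<le> q v)" for q r :: "'a \<Rightarrow> real"
  have "\<exists>m\<in>A. \<forall>q\<in>A. P m q \<longrightarrow> q = m"
  proof (rule predicate_Zorn)
    show "partial_order_on A (relation_of P A)"
    proof (rule partial_order_on_relation_ofI)
      fix q r s
      show "P q q" by (simp add: P_def)
      show "P q r \<Longrightarrow> P r s \<Longrightarrow> P q s" unfolding P_def by (meson order_trans)
      show "P q r \<Longrightarrow> P r q \<Longrightarrow> q = r" unfolding P_def by (intro ext antisym) auto
    qed
  next
    fix C assume C: "C \<in> Chains (relation_of P A)"
    then have CA: "C \<subseteq> A" and tot: "\<And>q r. q \<in> C \<Longrightarrow> r \<in> C \<Longrightarrow> P q r \<or> P r q"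
      by (auto simp: Chains_def relation_of_def)
    show "\<exists>u\<in>A. \<forall>q\<in>C. P q u"
    proof (cases "C = {}")
      case True
      with p show ?thesis by (auto simp: A_def)
    next
      case False
      have sub: "sublinear q" and le: "q v \<le> p v" if "q \<in> C" for q v
        using that CA by (auto simp: A_def)
      have total: "(\<forall>v. q v \<le> r v) \<or> (\<forall>v. r v \<le> q v)" if "q \<in> C" "r \<in> C" for q r
        using tot[OF that] by (auto simp: P_def)
      obtain u where u: "sublinear u" "\<And>q v. q \<in> C \<Longrightarrow> u v \<le> q v"
        by (rule Inf_chain_sublinear[of C p]) (use False sub le total in auto)
      have "u v \<le> p v" for v using False u(2) le by (metis ex_in_conv order_trans)
      with u show ?thesis by (auto simp: A_def P_def)
    qed
  qed
  then obtain m where m: "sublinear m" "\<And>v. m v \<le> p v"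
    and min: "\<And>q. q \<in> A \<Longrightarrow> P m q \<Longrightarrow> q = m" by (auto simp: A_def)
  have "linear m"
  proof (rule minimal_sublinear_imp_linear[OF m(1)])
    fix q assume "sublinear q" "\<And>v. q v \<le> m v"
    then show "q = m" using m(2) by (intro min) (auto simp: A_def P_def intro: order_trans)
  qed
  with m(2) that show thesis by blast
qed

text \<open>Take \<open>f\<close> linear below the norm lowered along \<open>- C\<close>; the bound
  by the norm makes it continuous. A singleton \<open>C\<close> gives norming functionals, a
  translated closed convex set gives Mazur's theorem.\<close>

lemma blinfun_bounded_below_on_convex:
  fixes C :: "'a::real_normed_vector set"
  assumes C: "convex C" "C \<noteq> {}" and d: "\<And>k. k \<in> C \<Longrightarrow> d \<le> norm k"
  obtains f :: "'a \<Rightarrow>\<^sub>L real" where "norm f \<le> 1" "\<And>k. k \<in> C \<Longrightarrow> d \<le> blinfun_apply f k"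
proof -
  obtain q :: "'a \<Rightarrow> real" where q: "sublinear q" "\<And>v. q v \<le> norm v" "\<And>k. k \<in> C \<Longrightarrow> q (- k) \<le> - d"
    using sublinear_minorant_on_convex[OF sublinear_norm C d] by blast
  obtain f where f: "linear f" "\<And>v. f v \<le> q v" using sublinear_dominates_linear[OF q(1)] by blast
  have neg: "f (- v) = - f v" for v using f(1) by (rule linear_neg)
  have abs: "\<bar>f v\<bar> \<le> norm v" for v
    using f(2)[of v] f(2)[of "- v"] q(2)[of v] q(2)[of "- v"] by (simp add: neg)
  have bl: "bounded_linear f"
    using f(1) abs by (auto intro!: bounded_linear_intro[where K=1] simp: linear_add linear_scale)
  have app: "blinfun_apply (Blinfun f) = f" using bl by (rule bounded_linear_Blinfun_apply)
  show thesis
  proof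
    show "norm (Blinfun f) \<le> 1" by (rule norm_blinfun_bound) (use abs in \<open>auto simp: app\<close>)
    show "d \<le> blinfun_apply (Blinfun f) k" if "k \<in> C" for k
      using f(2)[of "- k"] q(3)[OF that] by (simp add: app neg)
  qed
qed

lemma norming_blinfun:
  fixes x :: "'a::real_normed_vector"
  obtains f :: "'a \<Rightarrow>\<^sub>L real" where "norm f \<le> 1" "blinfun_apply f x = norm x"
proof -
  obtain f :: "'a \<Rightarrow>\<^sub>L real" where f: "norm f \<le> 1" "norm x \<le> blinfun_apply f x"
    using blinfun_bounded_below_on_convex[of "{x}" "norm x"] by auto
  have "blinfun_apply f x \<le> norm f * norm x"
    using norm_blinfun[of f x] by simp
  also have "\<dots> \<le> norm x" using f(1) by (simp add: mult_left_le_one_le)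
  finally show thesis using f that by force
qed

section \<open>The weak topology\<close>

lemma topspace_weak_topology [simp]: "topspace (weak_topology :: 'a::real_normed_vector topology) = UNIV"
proof -
  have "UNIV \<in> {blinfun_apply f -` U | (f :: 'a \<Rightarrow>\<^sub>L real) U. open U}"
    by (auto intro!: exI[of _ UNIV])
  then show ?thesis by (auto simp: weak_topology_def topology_generated_by_topspace)
qed

lemma openin_weak_topology_vimage:
  "open U \<Longrightarrow> openin weak_topology (blinfun_apply f -` U)" for f :: "'a::real_normed_vector \<Rightarrow>\<^sub>L real"
  unfolding weak_topology_def by (rule topology_generated_by_Basis) blast

lemma continuous_map_weak_topology:
  fixes g :: "'b \<Rightarrow> 'a::real_normed_vector"
  assumes "\<And>f :: 'a \<Rightarrow>\<^sub>L real. continuous_map X euclideanreal (\<lambda>x. blinfun_apply f (g x))"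
  shows "continuous_map X weak_topology g"
  unfolding weak_topology_def
proof (rule continuous_on_generated_topo)
  fix V assume "V \<in> {blinfun_apply f -` U | (f :: 'a \<Rightarrow>\<^sub>L real) U. open U}"
  then obtain f :: "'a \<Rightarrow>\<^sub>L real" and U where V: "V = blinfun_apply f -` U" "open U" by blast
  have "openin X {x \<in> topspace X. blinfun_apply f (g x) \<in> U}"
    using assms V(2) by (intro openin_continuous_map_preimage) auto
  also have "{x \<in> topspace X. blinfun_apply f (g x) \<in> U} = g -` V \<inter> topspace X"
    using V by auto
  finally show "openin X (g -` V \<inter> topspace X)" .
qed (use topspace_weak_topology in \<open>auto simp: weak_topology_def topology_generated_by_topspace\<close>)

lemma openin_weak_topology_imp_open:
  "openin weak_topology U \<Longrightarrow> open U" for U :: "'a::real_normed_vector set"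
proof -
  assume U: "openin weak_topology U"
  have "continuous_map euclidean weak_topology (\<lambda>x::'a. x)"
    by (rule continuous_map_weak_topology) (auto intro!: continuous_intros)
  from openin_continuous_map_preimage[OF this U] show ?thesis by simp
qed

text \<open>Mazur's theorem. If the ball of radius \<open>e\<close> around \<open>x\<close> misses
  \<open>K\<close>, some functional is at least \<open>e\<close> on \<open>K - x\<close>; the open
  half-space below its value at \<open>x\<close> plus \<open>e\<close> is a weak neighborhood of
  \<open>x\<close> off \<open>K\<close>.\<close>

lemma closedin_weak_topology_convex:
  fixes K :: "'a::real_normed_vector set"
  assumes "convex K" "closed K"
  shows "closedin weak_topology K"
proof -
  have "openin weak_topology (- K)"
  proof (subst openin_subopen, intro ballI)
    fix x assume x: "x \<in> - K"
    show "\<exists>T. openin weak_topology T \<and> x \<in> T \<and> T \<subseteq> - K"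
    proof (cases "K = {}")
      case True
      then show ?thesis using openin_topspace[of "weak_topology :: 'a topology"] by auto
    next
      case False
      obtain e where e: "e > 0" "ball x e \<subseteq> - K"
        using x assms(2) by (meson open_Compl open_contains_ball)
      have "e \<le> norm k" if "k \<in> (\<lambda>y. y - x) ` K" for k
      proof -
        from that obtain y where "y \<in> K" "k = y - x" by blast
        with e(2) have "y \<notin> ball x e" by blast
        then show ?thesis using \<open>k = y - x\<close> by (simp add: dist_norm norm_minus_commute)
      qed
      moreover have "convex ((\<lambda>y. y - x) ` K)" "(\<lambda>y. y - x) ` K \<noteq> {}"
        using assms(1) False by (auto simp: convex_translation_subtract_eq)
      ultimately obtain f :: "'a \<Rightarrow>\<^sub>L real"
        where f: "\<And>k. k \<in> (\<lambda>y. y - x) ` K \<Longrightarrow> e \<le> blinfun_apply f k"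
        using blinfun_bounded_below_on_convex by metis
      have "e \<le> blinfun_apply f y - blinfun_apply f x" if "y \<in> K" for y
        using f[of "y - x"] that by (simp add: blinfun.diff_right)
      then show ?thesis
        using openin_weak_topology_vimage[of "{..<blinfun_apply f x + e}" f] e(1) 
        by (intro exI[of _ "blinfun_apply f -` {..<blinfun_apply f x + e}"]) force
    qed
  qed
  then show ?thesis by (simp add: closedin_def Compl_eq_Diff_UNIV)
qed

text \<open>Banach--Alaoglu plus reflexivity: the linear maps in a product of compact intervals
  indexed by the dual form a compact set \<open>L\<close>. Each functional composed with
  \<open>\<psi>\<close> is a coordinate on \<open>L\<close>, so \<open>\<psi>\<close> maps
  \<open>L\<close> continuously onto the ball.\<close>

lemma compactin_weak_topology_cball:
  assumes "reflexive_space TYPE('a::real_normed_vector)" and r: "r \<ge> 0"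
  shows "compactin weak_topology (cball (0::'a) r)"
proof -
  define Q where "Q = (\<Pi>\<^sub>E f\<in>(UNIV :: ('a \<Rightarrow>\<^sub>L real) set). {- r * norm f..r * norm f})"
  define L where "L = {\<phi>. linear \<phi>} \<inter> Q"
  \<comment> \<open>The point representing \<open>\<phi>\<close>: reflexivity provides it for
    \<open>\<phi> \<in> L\<close>.\<close>
  define \<psi> where "\<psi> \<phi> = (SOME x::'a. \<forall>f. blinfun_apply f x = \<phi> f)" for \<phi> :: "('a \<Rightarrow>\<^sub>L real) \<Rightarrow> real"
  have "compactin (product_topology (\<lambda>_. euclideanreal) UNIV) Q"
    unfolding Q_def compactin_PiE by simp
  then have "compact Q" by (simp add: euclidean_product_topology)
  moreover have "closed {\<phi> :: ('a \<Rightarrow>\<^sub>L real) \<Rightarrow> real. linear \<phi>}"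
    unfolding linear_iff by (intro closed_Collect_conj closed_Collect_all closed_Collect_eq continuous_intros) auto
  ultimately have L: "compact L" unfolding L_def by (simp add: closed_Int_compact)
  have \<psi>: "blinfun_apply f (\<psi> \<phi>) = \<phi> f" if \<phi>: "\<phi> \<in> L" for \<phi> f
  proof -
    have lin: "linear \<phi>" and Q: "\<bar>\<phi> f\<bar> \<le> r * norm f" for f
      using \<phi> by (auto simp: L_def Q_def PiE_def Pi_def abs_le_iff minus_le_iff)
    have "bounded_linear \<phi>"
      using lin Q by (auto intro!: bounded_linear_intro[where K=r] simp: linear_add linear_scale mult.commute)
    then have app: "blinfun_apply (Blinfun \<phi>) = \<phi>" by (rule bounded_linear_Blinfun_apply)
    obtain x :: 'a where "Blinfun \<phi> = blinfun.prod_left x"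
      using assms(1) unfolding reflexive_space_def by (metis surjD)
    then have "\<forall>f. blinfun_apply f x = \<phi> f" by (metis app blinfun.prod_left.rep_eq)
    then show ?thesis unfolding \<psi>_def by (rule someI2) simp
  qed
  have "continuous_map (top_of_set L) weak_topology \<psi>"
  proof (rule continuous_map_weak_topology)
    fix f :: "'a \<Rightarrow>\<^sub>L real"
    have "continuous_on L (\<lambda>\<phi>. \<phi> f)" by (rule continuous_on_subset[OF continuous_on_product_coordinates]) auto
    then show "continuous_map (top_of_set L) euclideanreal (\<lambda>\<phi>. blinfun_apply f (\<psi> \<phi>))"
      by (simp add: \<psi> cong: continuous_on_cong)
  qed
  moreover have "compactin (top_of_set L) L" using L by (simp add: compactin_subtopology)
  ultimately have "compactin weak_topology (\<psi> ` L)" by (rule image_compactin[rotated])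
  also have "\<psi> ` L = cball 0 r"
  proof (intro equalityI subsetI)
    fix x assume "x \<in> \<psi> ` L"
    then obtain \<phi> where \<phi>: "\<phi> \<in> L" "x = \<psi> \<phi>" by blast
    obtain f :: "'a \<Rightarrow>\<^sub>L real" where f: "norm f \<le> 1" "blinfun_apply f x = norm x" by (rule norming_blinfun)
    have bd: "norm x \<le> r * norm f"
      using \<phi> \<psi>[OF \<phi>(1), of f] f(2) by (auto simp: L_def Q_def PiE_def Pi_def dest!: spec[of _ f])
    also have "\<dots> \<le> r" using f(1) r by (simp add: mult_left_le)
    finally show "x \<in> cball 0 r" by simp
  next
    fix x :: 'a assume x: "x \<in> cball 0 r"
    define \<phi> where "\<phi> = (\<lambda>f :: 'a \<Rightarrow>\<^sub>L real. blinfun_apply f x)"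
    have "\<bar>\<phi> f\<bar> \<le> r * norm f" for f
    proof -
      have "\<bar>\<phi> f\<bar> \<le> norm f * norm x" unfolding \<phi>_def using norm_blinfun[of f x] by simp
      also have "\<dots> \<le> norm f * r" using x by (intro mult_left_mono) auto
      finally show ?thesis by (simp add: mult.commute)
    qed
    then have "\<phi> \<in> L"
      by (auto simp: L_def Q_def \<phi>_def linear_iff blinfun.add_left blinfun.scaleR_left abs_le_iff minus_le_iff)
    \<comment> \<open>Functionals separate points, so the representing point is \<open>x\<close>
      itself.\<close>
    obtain f :: "'a \<Rightarrow>\<^sub>L real" where "blinfun_apply f (\<psi> \<phi> - x) = norm (\<psi> \<phi> - x)"
      by (rule norming_blinfun)
    then have "\<psi> \<phi> = x" using \<psi>[OF \<open>\<phi> \<in> L\<close>, of f] by (simp add: blinfun.diff_right \<phi>_def)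
    with \<open>\<phi> \<in> L\<close> show "x \<in> \<psi> ` L" by blast
  qed
  finally show ?thesis .
qed

section \<open>Brouwer and KKM\<close>

text \<open>
  The dimension \<open>n\<close> is a variable here, which the library's Brouwer theorem for Euclidean types
  does not allow: the points of the cube are sequences that vanish from index \<open>n\<close> on.
\<close>

definition cube_seq :: "nat \<Rightarrow> (nat \<Rightarrow> real) set" where
  "cube_seq n = {x. (\<forall>i<n. 0 \<le> x i \<and> x i \<le> 1) \<and> (\<forall>i\<ge>n. x i = 0)}"

lemma compact_cube_seq: "compact (cube_seq n)"
proof -
  have "cube_seq n = (\<Pi>\<^sub>E i\<in>UNIV. if i < n then {0..1} else {0})"
    unfolding cube_seq_def by (rule set_eqI) (simp add: PiE_iff not_less[symmetric]; metis atLeastAtMost_iff singletonD singletonI)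
  moreover have "compactin (product_topology (\<lambda>_. euclideanreal) (UNIV :: nat set))
      (\<Pi>\<^sub>E i\<in>UNIV. if i < n then {0..1} else {0})"
    by (simp add: compactin_PiE)
  ultimately show ?thesis by (simp add: euclidean_product_topology)
qed

lemma tendsto_coordinatewise_iff:
  fixes x :: "'a::type \<Rightarrow> 'b \<Rightarrow> 'c::topological_space"
  shows "(x \<longlongrightarrow> l) F \<longleftrightarrow> (\<forall>i. ((\<lambda>k. x k i) \<longlongrightarrow> l i) F)"
  using limitin_componentwise[of "\<lambda>_. euclidean" UNIV x l F]
  by (simp add: euclidean_product_topology)

text \<open>Kuhn's combinatorial lemma on the grid of mesh \<open>1 / p\<close> finds a cell that
  has, for each coordinate \<open>i\<close>, a vertex \<open>r i\<close> where \<open>T\<close> does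
  not decrease it and a vertex \<open>s i\<close> where \<open>T\<close> does not increase
  it.\<close>

lemma brouwer_approx:
  fixes T :: "(nat \<Rightarrow> real) \<Rightarrow> nat \<Rightarrow> real"
  assumes T: "\<And>x. x \<in> cube_seq n \<Longrightarrow> T x \<in> cube_seq n" and p: "p > 0"
  obtains z r s where "z \<in> cube_seq n"
    and "\<And>i. i < n \<Longrightarrow> r i \<in> cube_seq n" "\<And>i. i < n \<Longrightarrow> s i \<in> cube_seq n"
    and "\<And>i j. i < n \<Longrightarrow> \<bar>r i j - z j\<bar> \<le> 1 / real p" "\<And>i j. i < n \<Longrightarrow> \<bar>s i j - z j\<bar> \<le> 1 / real p"
    and "\<And>i. i < n \<Longrightarrow> r i i \<le> T (r i) i" "\<And>i. i < n \<Longrightarrow> T (s i) i \<le> s i i"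
proof -
  define g where "g q j = (if j < n then real (q j) / real p else 0)" for q :: "nat \<Rightarrow> nat" and j
  have g: "g q \<in> cube_seq n" if "\<And>i. i < n \<Longrightarrow> q i \<le> p" for q
    using that p by (auto simp: g_def cube_seq_def)
  \<comment> \<open>Kuhn's lemma demands label 1 on the face \<open>q i = p\<close>, hence the extra
    condition; on the face \<open>q i = 0\<close> label 0 is automatic, as \<open>T\<close> is
    nonnegative there.\<close>
  define label where "label q i = (if q i \<noteq> p \<and> g q i \<le> T (g q) i then 0 else 1::nat)" for q i
  obtain q where q: "\<forall>i<n. q i < p"
    and rs: "\<forall>i<n. \<exists>r s. (\<forall>j<n. q j \<le> r j \<and> r j \<le> q j + 1) \<and>
      (\<forall>j<n. q j \<le> s j \<and> s j \<le> q j + 1) \<and> label r i \<noteq> label s i"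
  proof (rule kuhn_lemma[OF p, of n label])
    show "\<forall>x. (\<forall>i<n. x i \<le> p) \<longrightarrow> (\<forall>i<n. x i = 0 \<longrightarrow> label x i = 0)"
      using T[OF g] p by (fastforce simp: label_def g_def cube_seq_def)
  qed (auto simp: label_def)
  \<comment> \<open>Kuhn's lemma only says that the labels differ; the two points are swapped if
    necessary.\<close>
  have "\<exists>r s. (\<forall>j<n. q j \<le> r j \<and> r j \<le> q j + 1) \<and> (\<forall>j<n. q j \<le> s j \<and> s j \<le> q j + 1) \<and>
      label r i = 0 \<and> label s i = 1" if "i < n" for i
  proof -
    obtain r s where "\<forall>j<n. q j \<le> r j \<and> r j \<le> q j + 1" "\<forall>j<n. q j \<le> s j \<and> s j \<le> q j + 1"
      "label r i \<noteq> label s i" using rs \<open>i < n\<close> by blast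
    moreover from this(3) have "label r i = 0 \<and> label s i = 1 \<or> label s i = 0 \<and> label r i = 1"
      by (auto simp: label_def split: if_splits)
    ultimately show ?thesis by blast
  qed
  then obtain r s where r: "\<And>i j. i < n \<Longrightarrow> j < n \<Longrightarrow> q j \<le> r i j \<and> r i j \<le> q j + 1"
    and s: "\<And>i j. i < n \<Longrightarrow> j < n \<Longrightarrow> q j \<le> s i j \<and> s i j \<le> q j + 1"
    and lr: "\<And>i. i < n \<Longrightarrow> label (r i) i = 0" and ls: "\<And>i. i < n \<Longrightarrow> label (s i) i = 1"
    by metis
  have gr: "g (r i) \<in> cube_seq n" and gs: "g (s i) \<in> cube_seq n" if "i < n" for i
    using r[OF that] s[OF that] q by (auto intro!: g) (meson Suc_leI order_trans)+
  have close: "\<bar>g t j - g q j\<bar> \<le> 1 / real p" if "j < n \<Longrightarrow> q j \<le> t j \<and> t j \<le> q j + 1" for t j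
    using that p by (auto simp: g_def simp flip: diff_divide_distrib intro!: divide_right_mono)
  show thesis
  proof
    show "g q \<in> cube_seq n" using q by (intro g) (auto intro: less_imp_le)
    show "\<bar>g (r i) j - g q j\<bar> \<le> 1 / real p" "\<bar>g (s i) j - g q j\<bar> \<le> 1 / real p" if "i < n" for i j
      using close r[OF that] s[OF that] by blast+
    show "g (r i) i \<le> T (g (r i)) i" if "i < n" for i
      using lr[OF that] by (auto simp: label_def split: if_splits)
    show "T (g (s i)) i \<le> g (s i) i" if "i < n" for i
    \<comment> \<open>A label 1 forced by the face says nothing about \<open>T\<close>, but there
      the coordinate already has the maximal value 1.\<close>
    proof (cases "s i i = p")
      case True
      then have "g (s i) i = 1" using p that by (simp add: g_def)
      then show ?thesis using T[OF gs[OF that]] that by (auto simp: cube_seq_def)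
    next
      case False
      then show ?thesis using ls[OF that] by (auto simp: label_def split: if_splits)
    qed
  qed (use gr gs in auto)
qed

text \<open>As the mesh tends to 0, the cells shrink along a subsequence to one point
  \<open>x\<close>; in the limit \<open>r\<close> gives \<open>x i \<le> T x i\<close> and
  \<open>s\<close> the reverse.\<close>

theorem brouwer_cube_seq:
  fixes T :: "(nat \<Rightarrow> real) \<Rightarrow> nat \<Rightarrow> real"
  assumes cont: "continuous_on (cube_seq n) T" and T: "\<And>x. x \<in> cube_seq n \<Longrightarrow> T x \<in> cube_seq n"
  obtains x where "x \<in> cube_seq n" "T x = x"
proof -
  define P where "P m z r s \<longleftrightarrow> z \<in> cube_seq n \<and> (\<forall>i<n. r i \<in> cube_seq n \<and> s i \<in> cube_seq n \<and>
      (\<forall>j. \<bar>r i j - z j\<bar> \<le> 1 / real (Suc m)) \<and> (\<forall>j. \<bar>s i j - z j\<bar> \<le> 1 / real (Suc m)) \<and>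
      r i i \<le> T (r i) i \<and> T (s i) i \<le> s i i)" for m z r s
  have "\<exists>z r s. P m z r s" for m
    unfolding P_def by (rule brouwer_approx[of n T "Suc m", OF T]) (simp, simp, blast)
  then obtain z r s where "\<And>m. P m (z m) (r m) (s m)" by metis
  then have z: "\<And>m. z m \<in> cube_seq n"
    and rs: "\<And>m i. i < n \<Longrightarrow> r m i \<in> cube_seq n" "\<And>m i. i < n \<Longrightarrow> s m i \<in> cube_seq n"
    and close: "\<And>m i j. i < n \<Longrightarrow> \<bar>r m i j - z m j\<bar> \<le> 1 / real (Suc m)"
      "\<And>m i j. i < n \<Longrightarrow> \<bar>s m i j - z m j\<bar> \<le> 1 / real (Suc m)"
    and le: "\<And>m i. i < n \<Longrightarrow> r m i i \<le> T (r m i) i" "\<And>m i. i < n \<Longrightarrow> T (s m i) i \<le> s m i i"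
    unfolding P_def by blast+
  obtain x \<sigma> where x: "x \<in> cube_seq n" and \<sigma>: "strict_mono (\<sigma> :: nat \<Rightarrow> nat)" and lim: "(z \<circ> \<sigma>) \<longlonglongrightarrow> x"
    using compact_cube_seq[of n] z unfolding compact_def by metis
  have lim_t: "(\<lambda>m. t (\<sigma> m)) \<longlonglongrightarrow> x"
    if t: "\<And>m j. \<bar>t m j - z m j\<bar> \<le> 1 / real (Suc m)" for t
    unfolding tendsto_coordinatewise_iff
  proof
    fix j
    have "(\<lambda>m. 1 / real (Suc m)) \<longlonglongrightarrow> 0" using LIMSEQ_inverse_real_of_nat by (simp add: inverse_eq_divide)
    then have "(\<lambda>m. 1 / real (Suc (\<sigma> m))) \<longlonglongrightarrow> 0"
      using LIMSEQ_subseq_LIMSEQ[OF _ \<sigma>] by (simp add: o_def)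
    then have "(\<lambda>m. t (\<sigma> m) j - z (\<sigma> m) j) \<longlonglongrightarrow> 0"
      by (rule Lim_null_comparison[rotated]) (use t in auto)
    moreover have "(\<lambda>m. z (\<sigma> m) j) \<longlonglongrightarrow> x j"
      using lim unfolding tendsto_coordinatewise_iff by (simp add: o_def)
    ultimately have "(\<lambda>m. (t (\<sigma> m) j - z (\<sigma> m) j) + z (\<sigma> m) j) \<longlonglongrightarrow> 0 + x j" by (rule tendsto_add)
    then show "(\<lambda>m. t (\<sigma> m) j) \<longlonglongrightarrow> x j" by simp
  qed
  have lim_T: "(\<lambda>m. T (t (\<sigma> m)) i) \<longlonglongrightarrow> T x i" and lim_i: "(\<lambda>m. t (\<sigma> m) i) \<longlonglongrightarrow> x i"
    if t: "\<And>m j. \<bar>t m j - z m j\<bar> \<le> 1 / real (Suc m)" "\<And>m. t m \<in> cube_seq n" for t i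
  proof -
    have "(\<lambda>m. T (t (\<sigma> m))) \<longlonglongrightarrow> T x"
      using cont x t(2) lim_t[OF t(1)] by (auto intro!: continuous_on_tendsto_compose[OF cont])
    then show "(\<lambda>m. T (t (\<sigma> m)) i) \<longlonglongrightarrow> T x i" by (simp add: tendsto_coordinatewise_iff)
    show "(\<lambda>m. t (\<sigma> m) i) \<longlonglongrightarrow> x i" using lim_t[OF t(1)] by (simp add: tendsto_coordinatewise_iff)
  qed
  have "T x i = x i" for i
  proof (cases "i < n")
    case True
    have "x i \<le> T x i"
      by (rule LIMSEQ_le[OF lim_i[of "\<lambda>m. r m i"] lim_T[of "\<lambda>m. r m i"]]) (use True close rs le in auto)
    moreover have "T x i \<le> x i"
      by (rule LIMSEQ_le[OF lim_T[of "\<lambda>m. s m i"] lim_i[of "\<lambda>m. s m i"]]) (use True close rs le in auto)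
    ultimately show ?thesis by simp
  next
    case False
    then show ?thesis using x T[OF x] by (simp add: cube_seq_def)
  qed
  with x that show thesis by blast
qed

text \<open>Otherwise the distances from a point of the hull to the sets \<open>G y\<close> have
  positive sum and, normalized, serve as weights of a new point. At a fixed point a weight vanishes
  exactly when the point lies in the corresponding set; but the point is in the hull of the
  \<open>y\<close> with nonzero weight, so it lies in the set of one of these.\<close>

theorem KKM_finite:
  fixes Y :: "'a::real_normed_vector set" and G :: "'a \<Rightarrow> 'a set"
  assumes Y: "finite Y" "Y \<noteq> {}" and closed: "\<And>y. y \<in> Y \<Longrightarrow> closed (G y)"
    and KKM: "\<And>A. A \<subseteq> Y \<Longrightarrow> A \<noteq> {} \<Longrightarrow> convex hull A \<subseteq> (\<Union>y\<in>A. G y)"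
  shows "convex hull Y \<inter> (\<Inter>y\<in>Y. G y) \<noteq> {}"
proof
  assume empty: "convex hull Y \<inter> (\<Inter>y\<in>Y. G y) = {}"
  define n where "n = card Y"
  have n: "n > 0" using Y by (simp add: n_def card_gt_0_iff)
  obtain y where y: "bij_betw y {..<n} Y"
    using ex_bij_betw_nat_finite[OF Y(1)] by (auto simp: n_def lessThan_atLeast0)
  have yY: "y i \<in> Y" if "i < n" for i using y that by (auto simp: bij_betw_def)
  \<comment> \<open>a retraction of the cube onto the simplex\<close>
  define \<sigma> where "\<sigma> x i = (x i + max 0 (1 - (\<Sum>j<n. x j)) / n) / max 1 (\<Sum>j<n. x j)" for x and i :: nat
  define \<phi> where "\<phi> x = (\<Sum>i<n. \<sigma> x i *\<^sub>R y i)" for x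
  define \<beta> where "\<beta> x i = infdist (\<phi> x) (G (y i))" for x i
  define T where "T x i = (if i < n then \<beta> x i / (\<Sum>j<n. \<beta> x j) else 0)" for x i
  have \<sigma>0: "\<sigma> x i \<ge> 0" if "x \<in> cube_seq n" "i < n" for x i
    using that by (auto simp: \<sigma>_def cube_seq_def)
  \<comment> \<open>If the coordinates sum to less than 1, \<open>\<sigma>\<close> spreads the
    deficit evenly; if to more, it divides by the sum.\<close>
  have \<sigma>1: "(\<Sum>i<n. \<sigma> x i) = 1" for x
    using n by (simp add: \<sigma>_def sum.distrib flip: sum_divide_distrib) (auto simp: max_def)
  have \<sigma>_id: "\<sigma> x i = x i" if "(\<Sum>j<n. x j) = 1" for x i
    using that by (simp add: \<sigma>_def)
  have hull: "\<phi> x \<in> convex hull Y" if "x \<in> cube_seq n" for x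
    unfolding \<phi>_def using that \<sigma>0 \<sigma>1 yY by (intro convex_sum) (auto intro: hull_inc)
  have \<beta>0: "\<beta> x i \<ge> 0" for x i by (simp add: \<beta>_def infdist_nonneg)
  \<comment> \<open>The KKM condition for a singleton gives \<open>y i \<in> G (y i)\<close>. This
    matters because \<open>infdist\<close> to the empty set is 0.\<close>
  have G_ne: "G (y i) \<noteq> {}" if "i < n" for i
    using KKM[of "{y i}"] yY[OF that] by auto
  have \<beta>_eq0: "\<beta> x i = 0 \<longleftrightarrow> \<phi> x \<in> G (y i)" if "i < n" for x i
    unfolding \<beta>_def using in_closed_iff_infdist_zero closed yY G_ne that by metis
  have \<beta>_pos: "(\<Sum>i<n. \<beta> x i) > 0" if "x \<in> cube_seq n" for x
  proof -
    have "\<not> (\<forall>i<n. \<beta> x i = 0)"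
    proof
      assume "\<forall>i<n. \<beta> x i = 0"
      then have "\<phi> x \<in> (\<Inter>y\<in>Y. G y)" using \<beta>_eq0 y by (auto simp: bij_betw_def)
      with hull[OF that] empty show False by blast
    qed
    then show ?thesis using \<beta>0[of x] by (metis lessThan_iff sum_pos2 finite_lessThan less_eq_real_def)
  qed
  have "continuous_on (cube_seq n) T"
  proof (rule continuous_on_coordinatewise_then_product)
    fix i
    have co: "continuous_on (cube_seq n) (\<lambda>x. x j)" for j
      by (rule continuous_on_subset[OF continuous_on_product_coordinates]) auto
    have "continuous_on (cube_seq n) (\<lambda>x. \<beta> x j)" for j
      unfolding \<beta>_def \<phi>_def \<sigma>_def using co n by (intro continuous_intros) auto
    then show "continuous_on (cube_seq n) (\<lambda>x. T x i)"
      unfolding T_def using \<beta>_pos by (cases "i < n") (auto intro!: continuous_intros simp: less_imp_neq[symmetric])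
  qed
  moreover have "T x \<in> cube_seq n" if "x \<in> cube_seq n" for x
    using \<beta>_pos[OF that] \<beta>0 by (auto simp: cube_seq_def T_def intro!: divide_nonneg_pos member_le_sum)
  ultimately obtain x where x: "x \<in> cube_seq n" "T x = x" by (rule brouwer_cube_seq)
  have xi: "x i = \<beta> x i / (\<Sum>j<n. \<beta> x j)" if "i < n" for i
    using x(2) that by (metis T_def)
  \<comment> \<open>The values of \<open>T\<close> sum to 1, so the fixed point lies in the simplex,
    where \<open>\<sigma>\<close> is the identity.\<close>
  have "(\<Sum>i<n. x i) = 1"
    using \<beta>_pos[OF x(1)] by (simp add: xi flip: sum_divide_distrib)
  then have \<phi>: "\<phi> x = (\<Sum>i<n. x i *\<^sub>R y i)" and sum1: "(\<Sum>i<n. x i) = 1" by (auto simp: \<phi>_def \<sigma>_id)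
  define J where "J = {i. i < n \<and> x i \<noteq> 0}"
  have J: "J \<subseteq> {..<n}" "finite J" by (auto simp: J_def)
  have sumJ: "(\<Sum>i\<in>J. x i) = 1"
    unfolding sum1[symmetric] using J by (intro sum.mono_neutral_left) (auto simp: J_def)
  then have "J \<noteq> {}" by auto
  have "\<phi> x = (\<Sum>i\<in>J. x i *\<^sub>R y i)"
    unfolding \<phi> using J by (intro sum.mono_neutral_right) (auto simp: J_def)
  also have "\<dots> \<in> convex hull (y ` J)"
    using J(2) sumJ x(1) by (intro convex_sum) (auto intro: hull_inc simp: J_def cube_seq_def)
  finally have "\<phi> x \<in> (\<Union>z\<in>y ` J. G z)"
    using KKM[of "y ` J"] \<open>J \<noteq> {}\<close> yY by (auto simp: J_def)
  then obtain i where i: "i < n" "x i \<noteq> 0" "\<phi> x \<in> G (y i)" by (auto simp: J_def)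
  then have "\<beta> x i = 0" using \<beta>_eq0 by simp
  with xi[OF i(1)] i(2) show False by simp
qed

section \<open>Segment-dense sets\<close>

text \<open>A functional norming \<open>y - x\<close> is isometric on the segment, so its weakly
  open strips cut out norm balls of the segment.\<close>

lemma closed_segment_subset_closure_weak_dense:
  fixes D :: "'a::real_normed_vector set"
  assumes "closed_segment x y \<subseteq> weak_topology closure_of (closed_segment x y \<inter> D)"
  shows "closed_segment x y \<subseteq> closure (closed_segment x y \<inter> D)"
proof
  fix z assume z: "z \<in> closed_segment x y"
  show "z \<in> closure (closed_segment x y \<inter> D)"
  proof (cases "x = y")
    case True
    obtain w where "w \<in> closed_segment x y \<inter> D"
      using z assms closure_of_empty by (metis ex_in_conv subsetD)
    then show ?thesis using True z closure_subset[of "closed_segment x y \<inter> D"] by auto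
  next
    case False
    obtain f :: "'a \<Rightarrow>\<^sub>L real" where f: "blinfun_apply f (y - x) = norm (y - x)" by (rule norming_blinfun)
    have iso: "\<bar>blinfun_apply f w - blinfun_apply f z\<bar> = dist w z"
      if w: "w \<in> closed_segment x y" for w
    proof -
      obtain s t where st: "w = (1 - s) *\<^sub>R x + s *\<^sub>R y" "z = (1 - t) *\<^sub>R x + t *\<^sub>R y"
        using w z unfolding in_segment by blast
      have wz: "w - z = (s - t) *\<^sub>R (y - x)" unfolding st by (simp add: algebra_simps)
      have "blinfun_apply f w - blinfun_apply f z = blinfun_apply f (w - z)"
        by (simp add: blinfun.diff_right)
      also have "\<dots> = (s - t) * norm (y - x)" unfolding wz blinfun.scaleR_right f by simp
      finally show ?thesis by (simp add: dist_norm wz abs_mult)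
    qed
    show ?thesis unfolding closure_approachable
    proof (intro allI impI)
      fix e :: real assume e: "e > 0"
      have "z \<in> weak_topology closure_of (closed_segment x y \<inter> D)" using z assms by blast
      moreover have "openin weak_topology (blinfun_apply f -` ball (blinfun_apply f z) e)"
        by (intro openin_weak_topology_vimage) auto
      moreover have "z \<in> blinfun_apply f -` ball (blinfun_apply f z) e" using e by simp
      ultimately obtain w where "w \<in> closed_segment x y \<inter> D" "w \<in> blinfun_apply f -` ball (blinfun_apply f z) e"
        unfolding in_closure_of by blast
      then show "\<exists>w\<in>closed_segment x y \<inter> D. dist w z < e"
        using iso by (auto simp: dist_real_def abs_minus_commute)
    qed
  qed
qed

text \<open>Induction on \<open>A\<close>. For \<open>b \<in> D\<close> in the smaller hull, density
  applies to the segment from \<open>a\<close> to \<open>b\<close>; a general \<open>b\<close> is a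
  limit of such points, and \<open>u *\<^sub>R a + v *\<^sub>R b\<close> depends continuously on
  \<open>b\<close>.\<close>

lemma convex_hull_subset_closure_of_segment_dense:
  fixes D :: "'a::real_normed_vector set"
  assumes dense: "\<And>x y. x \<in> D \<Longrightarrow> y \<in> D \<Longrightarrow> closed_segment x y \<subseteq> closure (closed_segment x y \<inter> D)"
    and "finite A" "A \<subseteq> D"
  shows "convex hull A \<subseteq> closure (convex hull A \<inter> D)"
  using assms(2,3)
proof (induction A rule: finite_induct)
  case (insert a A)
  let ?H = "convex hull insert a A"
  show ?case
  proof (cases "A = {}")
    case True
    then show ?thesis using insert.prems closure_subset[of "{a} \<inter> D"] by auto
  next
    case False
    show ?thesis
    proof
      fix z assume "z \<in> ?H"
      then obtain u v b where uv: "u \<ge> 0" "v \<ge> 0" "u + v = 1" and b: "b \<in> convex hull A"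
        and z: "z = u *\<^sub>R a + v *\<^sub>R b"
        unfolding convex_hull_insert[OF False] by blast
      have "(\<lambda>b. u *\<^sub>R a + v *\<^sub>R b) ` closure (convex hull A \<inter> D) \<subseteq> closure (?H \<inter> D)"
      proof (rule image_closure_subset)
        show "(\<lambda>b. u *\<^sub>R a + v *\<^sub>R b) ` (convex hull A \<inter> D) \<subseteq> closure (?H \<inter> D)"
        proof clarify
          fix b assume b: "b \<in> convex hull A" "b \<in> D"
          have "b \<in> ?H" using b(1) hull_mono[of A "insert a A" convex] by blast
          then have "closed_segment a b \<subseteq> ?H"
            by (intro closed_segment_subset) (auto intro: hull_inc)
          moreover have "u *\<^sub>R a + v *\<^sub>R b \<in> closed_segment a b"
            using uv by (auto simp: in_segment intro!: exI[of _ v])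
          ultimately show "u *\<^sub>R a + v *\<^sub>R b \<in> closure (?H \<inter> D)"
            using dense[of a b] b(2) insert.prems closure_mono[of "closed_segment a b \<inter> D" "?H \<inter> D"]
            by blast
        qed
      qed (auto intro!: continuous_intros)
      then show "z \<in> closure (?H \<inter> D)" using insert b z by blast
    qed
  qed
qed simp

section \<open>Set-valued maps into the reals\<close>

text \<open>The half-line \<open>{..<0}\<close> is open, so upper semicontinuity makes negativity
  persist nearby.\<close>

lemma usc_at_negative:
  fixes T :: "'a \<Rightarrow> real set"
  assumes "usc_at X T x" "T x \<inter> {0..} = {}"
  obtains M where "openin X M" "x \<in> M" "\<And>y. y \<in> M \<Longrightarrow> T y \<inter> {0..} = {}"
proof -
  have "T x \<subseteq> {..<0}" using assms(2) by (auto simp: disjoint_iff not_le)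
  then obtain M where "openin X M" "x \<in> M" "\<And>y. y \<in> M \<Longrightarrow> T y \<subseteq> {..<0}"
    using assms(1) unfolding usc_at_def by (metis open_lessThan)
  with that show thesis by (force simp: disjoint_iff)
qed

lemma closedin_usc_nonneg:
  fixes T :: "'a \<Rightarrow> real set"
  assumes "usc_on (subtopology X K) K T" "closedin X K"
  shows "closedin X {x\<in>K. T x \<inter> {0..} \<noteq> {}}"
proof -
  let ?S = "{x\<in>K. T x \<inter> {0..} \<noteq> {}}"
  have K: "topspace (subtopology X K) = K"
    using closedin_subset[OF assms(2)] by (rule topspace_subtopology_subset)
  have "openin (subtopology X K) (K - ?S)"
  proof (subst openin_subopen, intro ballI)
    fix x assume "x \<in> K - ?S"
    then have x: "usc_at (subtopology X K) T x" "T x \<inter> {0..} = {}" using assms(1) by (auto simp: usc_on_def)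
    obtain M where M: "openin (subtopology X K) M" "x \<in> M" "\<And>y. y \<in> M \<Longrightarrow> T y \<inter> {0..} = {}"
      using usc_at_negative[OF x] by blast
    then show "\<exists>M. openin (subtopology X K) M \<and> x \<in> M \<and> M \<subseteq> K - ?S"
      using openin_subset[OF M(1)] K by blast
  qed
  then have "closedin (subtopology X K) ?S" by (auto simp: closedin_def K simp del: topspace_subtopology)
  then show ?thesis using assms(2) by (rule closedin_trans_full)
qed

text \<open>Source of the KKM property: an element of \<open>T z\<close> is a convex combination of
  elements of the \<open>T a\<close>, hence negative if all of those are.\<close>

lemma set_valued_concave_on_convex_hull:
  assumes T: "set_valued_concave_on D T" and A: "A \<subseteq> D" and z: "z \<in> convex hull A" "z \<in> D"
    and neg: "\<And>a. a \<in> A \<Longrightarrow> T a \<inter> {0..} = {}"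
  shows "T z \<inter> {0..} = {}"
proof -
  obtain k u x where ux: "\<forall>i\<in>{1::nat..k}. 0 \<le> u i \<and> x i \<in> A" "sum u {1..k} = 1"
    "(\<Sum>i=1..k. u i *\<^sub>R x i) = z"
    using z(1) unfolding convex_hull_indexed by blast
  have sub: "T z \<subseteq> (\<Sum>i=1..k. u i *o T (x i))"
  proof -
    have "\<forall>i\<in>{1..k}. x i \<in> D \<and> 0 \<le> u i" using ux(1) A by blast
    with ux(2,3) z(2) show ?thesis
      using T[unfolded set_valued_concave_on_def, THEN spec[of _ k], THEN spec[of _ x], THEN spec[of _ u]]
      by simp
  qed
  have "t < 0" if "t \<in> T z" for t
  proof -
    have "t \<in> (\<Sum>i=1..k. u i *o T (x i))" using that sub by blast
    then obtain s where s: "t = sum s {1..k}" "\<And>i. i \<in> {1..k} \<Longrightarrow> s i \<in> u i *o T (x i)"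
      by (auto simp: set_sum_alt)
    \<comment> \<open>A zero weight contributes 0, so strictness must come from a positive weight;
      one exists because the weights sum to 1.\<close>
    have *: "s i \<le> 0 \<and> (u i > 0 \<longrightarrow> s i < 0)" if i: "i \<in> {1..k}" for i
    proof -
      obtain b where b: "b \<in> T (x i)" "s i = u i * b" using s(2)[OF i] by (auto simp: elt_set_times_def)
      then have "b < 0" using neg[of "x i"] ux(1) i by (force simp: disjoint_iff)
      then show ?thesis using b ux(1) i by (auto simp: mult_nonneg_nonpos mult_pos_neg)
    qed
    have "\<exists>i\<in>{1..k}. u i > 0"
    proof (rule ccontr)
      assume "\<not> ?thesis"
      then have "sum u {1..k} = 0" using ux(1) by (intro sum.neutral) force
      with ux(2) show False by simp
    qed
    then have "\<exists>i\<in>{1..k}. s i < 0" using * by blast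
    then have "sum s {1..k} < (\<Sum>i=1..k. 0)" using * by (intro sum_strict_mono_ex1) simp_all
    then show "t < 0" using s(1) by simp
  qed
  then show ?thesis by (force simp: disjoint_iff)
qed

text \<open>A nonnegative \<open>(1 - t) * u + t * v\<close> with \<open>u \<le> 0\<close> forces
  \<open>t * v \<ge> 0\<close>, and \<open>t > 0\<close> gives \<open>v \<ge> 0\<close>.\<close>

lemma set_valued_concave_on_segment:
  assumes T: "set_valued_concave_on D T" and D: "a \<in> D" "b \<in> D" "(1 - t) *\<^sub>R a + t *\<^sub>R b \<in> D"
    and t: "0 < t" "t \<le> 1" and a: "\<forall>u\<in>T a. u \<le> 0"
    and pos: "T ((1 - t) *\<^sub>R a + t *\<^sub>R b) \<inter> {0..} \<noteq> {}"
  shows "T b \<inter> {0..} \<noteq> {}"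
proof -
  define x where "x i = (if i = 1 then a else b)" for i :: nat
  define l where "l i = (if i = 1 then 1 - t else t)" for i :: nat
  have "(\<Sum>i=1..2. l i *\<^sub>R x i) = (1 - t) *\<^sub>R a + t *\<^sub>R b" "(\<Sum>i=1..2. l i) = 1"
    by (simp_all add: numeral_2_eq_2 l_def x_def)
  moreover have "\<forall>i\<in>{1..2}. x i \<in> D \<and> 0 \<le> l i" using D t by (auto simp: x_def l_def)
  ultimately have "T ((1 - t) *\<^sub>R a + t *\<^sub>R b) \<subseteq> (\<Sum>i=1..2. l i *o T (x i))"
    using T[unfolded set_valued_concave_on_def, THEN spec[of _ 2], THEN spec[of _ x], THEN spec[of _ l]] D(3)
    by simp
  also have "\<dots> = (1 - t) *o T a + t *o T b" by (simp add: numeral_2_eq_2 l_def x_def)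
  finally obtain u v where uv: "u \<in> T a" "v \<in> T b" "(1 - t) * u + t * v \<ge> 0"
    using pos by (force simp: set_plus_def elt_set_times_def)
  have "(1 - t) * u \<le> 0" using a uv(1) t by (simp add: mult_nonneg_nonpos)
  with uv(3) have "t * v \<ge> 0" by simp
  then have "v \<ge> 0" using t by (simp add: zero_le_mult_iff)
  with uv(2) show ?thesis by auto
qed

section \<open>The inequality on a weakly compact set and its extension to \<open>K\<close>\<close>

lemma set_valued_concave_on_subset:
  "set_valued_concave_on D T \<Longrightarrow> E \<subseteq> D \<Longrightarrow> set_valued_concave_on E T"
  unfolding set_valued_concave_on_def by blast

text \<open>Concavity and the diagonal condition give the covering at points of \<open>D\<close>,
  segment density extends it to whole hulls, and weak compactness passes from finitely many indices
  to all of \<open>D\<close>.\<close>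

theorem ky_fan_segment_dense:
  fixes C D :: "'a::real_normed_vector set" and F :: "'a \<Rightarrow> 'a \<Rightarrow> real set"
  assumes C: "compactin weak_topology C" "convex C" "C \<noteq> {}" and D: "D \<subseteq> C"
    and dense: "\<And>x y. x \<in> D \<Longrightarrow> y \<in> D \<Longrightarrow> closed_segment x y \<subseteq> closure (closed_segment x y \<inter> D)"
    and closed: "\<And>y. y \<in> D \<Longrightarrow> closedin weak_topology {x\<in>C. F x y \<inter> {0..} \<noteq> {}}"
    and concave: "\<And>x. x \<in> D \<Longrightarrow> set_valued_concave_on D (F x)"
    and diag: "\<And>x. x \<in> D \<Longrightarrow> F x x \<inter> {0..} \<noteq> {}"
  shows "\<exists>x\<in>C. \<forall>y\<in>D. F x y \<inter> {0..} \<noteq> {}"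
proof -
  define G where "G y = {x\<in>C. F x y \<inter> {0..} \<noteq> {}}" for y
  have G: "closedin weak_topology (G y)" if "y \<in> D" for y
    unfolding G_def using that by (rule closed)
  \<comment> \<open>\<open>KKM_finite\<close> and the closure argument use norm closedness; the
    compactness argument uses weak closedness.\<close>
  have G_closed: "closed (G y)" if "y \<in> D" for y
    using G[OF that] openin_weak_topology_imp_open[of "- G y"]
    by (simp add: closedin_def Compl_eq_Diff_UNIV closed_def)
  have KKM: "convex hull A \<subseteq> (\<Union>y\<in>A. G y)" if A: "finite A" "A \<subseteq> D" for A
  proof -
    have "convex hull A \<inter> D \<subseteq> (\<Union>y\<in>A. G y)"
    proof
      fix z assume z: "z \<in> convex hull A \<inter> D"
      show "z \<in> (\<Union>y\<in>A. G y)"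
      proof (rule ccontr)
        assume "z \<notin> (\<Union>y\<in>A. G y)"
        then have "\<And>a. a \<in> A \<Longrightarrow> F z a \<inter> {0..} = {}" using z D by (auto simp: G_def)
        \<comment> \<open>Concavity of \<open>F z\<close> in its second argument is evaluated at the
          hull point \<open>z\<close> itself.\<close>
        then have "F z z \<inter> {0..} = {}"
          using set_valued_concave_on_convex_hull[of D "F z" A z] z A concave by auto
        with diag z show False by blast
      qed
    qed
    then have "closure (convex hull A \<inter> D) \<subseteq> (\<Union>y\<in>A. G y)"
      using A G_closed by (intro closure_minimal closed_UN) auto
    with convex_hull_subset_closure_of_segment_dense[OF dense A] show ?thesis by blast
  qed
  have "C \<inter> \<Inter>\<F> \<noteq> {}" if \<F>: "finite \<F>" "\<F> \<subseteq> G ` D" for \<F>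
  proof (cases "\<F> = {}")
    case True
    then show ?thesis using C(3) by simp
  next
    case False
    obtain Y where Y: "finite Y" "Y \<subseteq> D" "\<F> = G ` Y"
      using finite_subset_image[OF \<F>] by blast
    with False have "Y \<noteq> {}" by auto
    with Y(1) have "convex hull Y \<inter> (\<Inter>y\<in>Y. G y) \<noteq> {}"
    proof (rule KKM_finite)
      show "closed (G y)" if "y \<in> Y" for y using G_closed that Y(2) by blast
      show "convex hull A \<subseteq> (\<Union>y\<in>A. G y)" if "A \<subseteq> Y" for A
        using KKM[of A] that Y(1,2) finite_subset by blast
    qed
    moreover have "convex hull Y \<subseteq> C" using Y D C(2) by (intro hull_minimal) auto
    ultimately show ?thesis using Y by blast
  qed
  moreover have "\<forall>U\<in>G ` D. closedin weak_topology U" using G by blast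
  ultimately have "C \<inter> \<Inter>(G ` D) \<noteq> {}"
    using C(1)[unfolded compactin_fip, THEN conjunct2, THEN spec] by simp
  then show ?thesis by (auto simp: G_def)
qed

text \<open>Since \<open>a\<close> is strictly inside the ball, the segment has a point
  \<open>z \<noteq> a\<close> of \<open>D\<close> in the ball. There \<open>near\<close> applies,
  and concavity carries nonnegativity on to \<open>y\<close>.\<close>

lemma nonneg_on_segment_dense:
  fixes D :: "'a::real_normed_vector set"
  assumes T: "set_valued_concave_on D T"
    and dense: "closed_segment a y \<subseteq> closure (closed_segment a y \<inter> D)"
    and a: "a \<in> D" "norm a < r" "\<forall>u\<in>T a. u \<le> 0" and y: "y \<in> D"
    and near: "\<And>z. z \<in> D \<Longrightarrow> norm z \<le> r \<Longrightarrow> T z \<inter> {0..} \<noteq> {}"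
  shows "T y \<inter> {0..} \<noteq> {}"
proof (cases "y = a")
  case True
  then show ?thesis using near a by simp
next
  case False
  \<comment> \<open>Moving from \<open>a\<close> towards \<open>y\<close> by the fraction
    \<open>\<tau>\<close> uses at most half of the gap \<open>r - norm a\<close>.\<close>
  define \<tau> where "\<tau> = min 1 ((r - norm a) / (2 * norm (y - a)))"
  have ny: "norm (y - a) > 0" using False by simp
  have \<tau>: "0 < \<tau>" "\<tau> \<le> 1" using ny a(2) by (auto simp: \<tau>_def)
  define m where "m = (1 - \<tau>) *\<^sub>R a + \<tau> *\<^sub>R y"
  have m: "m = a + \<tau> *\<^sub>R (y - a)" by (simp add: m_def algebra_simps)
  have "\<tau> * norm (y - a) \<le> (r - norm a) / (2 * norm (y - a)) * norm (y - a)"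
    by (intro mult_right_mono) (auto simp: \<tau>_def)
  also have "\<dots> = (r - norm a) / 2" using ny by simp
  also have "\<dots> < r - norm a" using a(2) by simp
  finally have "norm m < r"
    using norm_triangle_ineq[of a "\<tau> *\<^sub>R (y - a)"] \<tau> by (simp add: m)
  moreover have "m \<noteq> a" using \<tau> False by (simp add: m)
  moreover have "m \<in> closed_segment a y" using \<tau> unfolding m_def in_segment by (metis less_imp_le)
  then have "m \<in> closure (closed_segment a y \<inter> D)" using dense by blast
  \<comment> \<open>This set is open and contains \<open>m\<close>, so it meets \<open>D\<close> on
    the segment; leaving out \<open>a\<close> ensures \<open>t \<noteq> 0\<close> below.\<close>
  ultimately have "(ball 0 r - {a}) \<inter> closure (closed_segment a y \<inter> D) \<noteq> {}" by auto
  then have "(ball 0 r - {a}) \<inter> (closed_segment a y \<inter> D) \<noteq> {}"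
    by (subst (asm) open_Int_closure_eq_empty) (auto simp: open_Diff)
  then obtain z where z: "z \<in> closed_segment a y" "z \<in> D" "z \<in> ball 0 r - {a}" by blast
  then obtain t where t: "0 \<le> t" "t \<le> 1" "z = (1 - t) *\<^sub>R a + t *\<^sub>R y" by (auto simp: in_segment)
  have "t \<noteq> 0" using t(3) z(3) by auto
  moreover have "T z \<inter> {0..} \<noteq> {}" using near z by simp
  ultimately show ?thesis
    using set_valued_concave_on_segment[OF T a(1) y, of t] a(3) z(2) t by auto
qed

text \<open>Were \<open>T y\<close> negative, it would be so on a neighborhood of \<open>y\<close>
  in all of \<open>K\<close>, which meets \<open>D\<close> by density. A neighborhood relative to
  \<open>K - D\<close> would contain no point of \<open>D\<close>.\<close>

lemma nonneg_of_dense: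
  assumes usc: "usc_on (subtopology X K) (K - D) T" and D: "D \<subseteq> K" "K \<subseteq> X closure_of D"
    and nonneg: "\<And>y. y \<in> D \<Longrightarrow> T y \<inter> {0..} \<noteq> {}" and y: "y \<in> K"
  shows "(T y :: real set) \<inter> {0..} \<noteq> {}"
proof
  assume neg: "T y \<inter> {0..} = {}"
  with nonneg y have "y \<in> K - D" by blast
  with usc have at: "usc_at (subtopology X K) T y" by (simp add: usc_on_def)
  obtain M where M: "openin (subtopology X K) M" "y \<in> M" "\<And>z. z \<in> M \<Longrightarrow> T z \<inter> {0..} = {}"
    using usc_at_negative[OF at neg] by blast
  obtain U where U: "openin X U" "M = U \<inter> K" using M(1) by (auto simp: openin_subtopology)
  have "y \<in> X closure_of D" using D y by blast
  then obtain z where "z \<in> D" "z \<in> U" using U M(2) unfolding in_closure_of by blast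
  with U M(3) D nonneg show False by blast
qed

text \<open>For a ball that misses \<open>K\<close>, the implication in (v) holds vacuously; the
  conjunct \<open>\<exists>x\<in>K. norm x \<le> r\<close> rules this out and makes \<open>C\<close>
  nonempty.\<close>

theorem theorem4p6:
  fixes K D :: "'a::banach set" and F :: "'a \<Rightarrow> 'a \<Rightarrow> real set"
  assumes "reflexive_space TYPE('a)"
    and "K \<noteq> {}" and "convex K" and "closed K"
    and "D \<subseteq> K" and "self_segment_dense_in weak_topology D K"
    and "\<forall>y\<in>D. usc_on (subtopology weak_topology K) K (\<lambda>x. F x y)"
    and "\<forall>x\<in>K. usc_on (subtopology weak_topology K) (K - D) (\<lambda>y. F x y)"
    and "\<forall>x\<in>K. set_valued_concave_on D (\<lambda>y. F x y)"
    and "\<forall>x\<in>D. F x x \<inter> {0..} \<noteq> {}"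
    and "\<exists>r>0. (\<exists>x\<in>K. norm x \<le> r) \<and>
           (\<forall>x\<in>K. norm x \<le> r \<longrightarrow> (\<exists>y\<^sub>0\<in>D. norm y\<^sub>0 < r \<and> (\<forall>u\<in>F x y\<^sub>0. u \<le> 0)))"
  shows "\<exists>x\<^sub>0\<in>K. \<forall>y\<in>K. F x\<^sub>0 y \<inter> {0..} \<noteq> {}"
proof -
  obtain r where r: "r > 0" and x1: "\<exists>x\<in>K. norm x \<le> r"
    and coercive: "\<And>x. x \<in> K \<Longrightarrow> norm x \<le> r \<Longrightarrow> \<exists>y\<^sub>0\<in>D. norm y\<^sub>0 < r \<and> (\<forall>u\<in>F x y\<^sub>0. u \<le> 0)"
    using assms(11) by blast
  have dense: "closed_segment x y \<subseteq> closure (closed_segment x y \<inter> D)" if "x \<in> D" "y \<in> D" for x y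
    using assms(6) that by (intro closed_segment_subset_closure_weak_dense) (simp add: self_segment_dense_in_def)
  have K: "closedin weak_topology K" using assms(3,4) by (rule closedin_weak_topology_convex)
  define C where "C = K \<inter> cball 0 r"
  have C: "compactin weak_topology C" "convex C" "C \<noteq> {}"
    using K compactin_weak_topology_cball[OF assms(1), of r] r x1 assms(3)
    by (auto simp: C_def intro: closed_Int_compactin convex_Int)
  have "\<exists>x\<in>C. \<forall>y\<in>D \<inter> C. F x y \<inter> {0..} \<noteq> {}"
  proof (rule ky_fan_segment_dense[OF C, of "D \<inter> C" F])
    fix x y assume xy: "x \<in> D \<inter> C" "y \<in> D \<inter> C"
    \<comment> \<open>Segments between points of the convex set \<open>C\<close> stay in
      \<open>C\<close>, so \<open>D \<inter> C\<close> inherits segment density.\<close>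
    then have "closed_segment x y \<inter> (D \<inter> C) = closed_segment x y \<inter> D"
      using closed_segment_subset[OF _ _ C(2)] by blast
    with dense xy show "closed_segment x y \<subseteq> closure (closed_segment x y \<inter> (D \<inter> C))" by simp
  next
    fix y assume "y \<in> D \<inter> C"
    then have "closedin weak_topology {x\<in>K. F x y \<inter> {0..} \<noteq> {}}"
      using assms(7) K by (intro closedin_usc_nonneg) auto
    moreover have "closedin weak_topology (cball (0::'a) r)" by (intro closedin_weak_topology_convex) auto
    ultimately have "closedin weak_topology ({x\<in>K. F x y \<inter> {0..} \<noteq> {}} \<inter> cball 0 r)" by (rule closedin_Int)
    also have "{x\<in>K. F x y \<inter> {0..} \<noteq> {}} \<inter> cball 0 r = {x\<in>C. F x y \<inter> {0..} \<noteq> {}}"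
      by (auto simp: C_def)
    finally show "closedin weak_topology {x\<in>C. F x y \<inter> {0..} \<noteq> {}}" .
  next
    fix x assume "x \<in> D \<inter> C"
    then have "set_valued_concave_on D (F x)" using assms(5,9) by blast
    then show "set_valued_concave_on (D \<inter> C) (F x)" by (rule set_valued_concave_on_subset) blast
  next
    show "F x x \<inter> {0..} \<noteq> {}" if "x \<in> D \<inter> C" for x using assms(10) that by blast
  qed simp
  then obtain x\<^sub>0 where x0: "x\<^sub>0 \<in> C" and near: "\<And>y. y \<in> D \<inter> C \<Longrightarrow> F x\<^sub>0 y \<inter> {0..} \<noteq> {}" by blast
  have x0K: "x\<^sub>0 \<in> K" using x0 by (simp add: C_def)
  \<comment> \<open>The point \<open>y\<^sub>0\<close> depends on \<open>x\<^sub>0\<close>;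
    condition (v) applies because \<open>x\<^sub>0\<close> lies in the ball.\<close>
  obtain y\<^sub>0 where y0: "y\<^sub>0 \<in> D" "norm y\<^sub>0 < r" "\<forall>u\<in>F x\<^sub>0 y\<^sub>0. u \<le> 0"
    using coercive[of x\<^sub>0] x0 by (auto simp: C_def)
  have concave: "set_valued_concave_on D (F x\<^sub>0)" using assms(9) x0K by simp
  have on_D: "F x\<^sub>0 y \<inter> {0..} \<noteq> {}" if y: "y \<in> D" for y
  proof (rule nonneg_on_segment_dense[OF concave dense[OF y0(1) y] y0 y])
    show "F x\<^sub>0 z \<inter> {0..} \<noteq> {}" if "z \<in> D" "norm z \<le> r" for z
      using near[of z] that assms(5) by (auto simp: C_def)
  qed
  have usc: "usc_on (subtopology weak_topology K) (K - D) (F x\<^sub>0)" using assms(8) x0K by simp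
  have "K \<subseteq> weak_topology closure_of D" using assms(6) by (simp add: self_segment_dense_in_def)
  from nonneg_of_dense[OF usc assms(5) this on_D] x0K show ?thesis by blast
qed

end
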